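(* Let $g:\mathbb{R}^n\times[0,\infty)\to\mathbb{R}^n$ and consider the system $\dot x=g(x,t)$, $x\in\mathbb{R}^n$, $t\ge 0$. Suppose it is contracting with contraction rate $\bar\gamma(t)>0$ for all $t\ge 0$ with respect to the norm $\|\cdot\|_{2,P^{1/2}}$ for some symmetric positive-definite $P\in\mathbb{R}^{n\times n}$. Let $(y_k)_{k\ge 0}$ be a sequence generated by the implicit Euler discretization with constant step-size $h>0$, i.e. $y_{k+1}=y_k+h\,g(y_{k+1},(k+1)h)$ for $k=0,1,\dots$, with given $y_0\in\mathbb{R}^n$. (1) If there exists $x^*\in\mathbb{R}^n$ such that $g(x^*,t)=0$ for all $t\ge 0$, then for $k=1,2,\dots$ $$\|y_k-x^*\|_{2,P^{1/2}}\le\Big(\prod_{m=1}^k(1+h\bar\gamma(mh))^{-1}\Big)\|y_0-x^*\|_{2,P^{1/2}};$$ and if additionally the contraction rate is time-invariant, $\bar\gamma(t)\equiv\gamma>0$, then $$\|y_k-x^*\|_{2,P^{1/2}}\le(1+h\gamma)^{-k}\|y_0-x^*\|_{2,P^{1/2}}.$$ (2) If there exists a curve $t\mapsto x^*(t)\in\mathbb{R}^n$ such that $g(x^*(t),t)=0$ for all $t\ge 0$, then for $k=1,2,\dots$ $$\|y_k-x^*(kh)\|_{2,P^{1/2}}\le\Big(\prod_{m=1}^k(1+h\bar\gamma(mh))^{-1}\Big)\|y_0-x^*(0)\|_{2,P^{1/2}}+\sum_{m=1}^k\Big(\prod_{r=m}^k(1+h\bar\gamma(rh))^{-1}\Big)\|x^*(mh)-x^*((m-1)h)\|_{2,P^{1/2}};$$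 and if additionally $\bar\gamma(t)\equiv\gamma>0$ and $\sup_{k=1,2,\dots}\|x^*(kh)-x^*((k-1)h)\|_{2,P^{1/2}}\le\rho$ for some constant $\rho\ge 0$, then $$\|y_k-x^*(kh)\|_{2,P^{1/2}}\le(1+h\gamma)^{-k}\|y_0-x^*(0)\|_{2,P^{1/2}}+\rho\sum_{m=1}^k(1+h\gamma)^{-m},$$ and so $$\limsup_{k\to\infty}\|y_k-x^*(kh)\|_{2,P^{1/2}}\le\frac{\rho}{h\gamma}.$$
   Context: For symmetric positive-definite $P$, $\|x\|_{2,P^{1/2}}=\|P^{1/2}x\|_2=\sqrt{x^\top Px}$. It is assumed that a solution of $\dot x=g(x,t)$ exists for every initial condition. The system is contracting with respect to $\|\cdot\|_{2,P^{1/2}}$ with contraction rate $\bar\gamma(t)$ (an integrable function with $\int_{t_0}^t\bar\gamma(s)\,ds>0$ for $t>t_0$) if the one-sided Lipschitz condition $$(x-y)^\top P\,(g(x,t)-g(y,t))\le-\bar\gamma(t)\|x-y\|_{2,P^{1/2}}^2$$ holds for all $x,y\in\mathbb{R}^n$ and all $t\ge t_0$ (here $t_0=0$). *)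

theory Defs
  imports "HOL-Analysis.Analysis"
begin

definition sym_posdef :: "real ^ 'n ^ 'n \<Rightarrow> bool" where
  "sym_posdef P \<longleftrightarrow> transpose P = P \<and> (\<forall>x. x \<noteq> 0 \<longrightarrow> x \<bullet> (P *v x) > 0)"

text \<open>The principal square root; existence and uniqueness are established in
  \<open>ex1_matrix_sqrt\<close> below.\<close>

definition matrix_sqrt :: "real ^ 'n ^ 'n \<Rightarrow> real ^ 'n ^ 'n" where
  "matrix_sqrt P = (THE S. sym_posdef S \<and> S ** S = P)"

definition weighted_norm :: "real ^ 'n ^ 'n \<Rightarrow> real ^ 'n \<Rightarrow> real" where
  "weighted_norm P x = norm (matrix_sqrt P *v x)"

definition solution_from ::
  "real \<Rightarrow> (real ^ 'n \<Rightarrow> real \<Rightarrow> real ^ 'n) \<Rightarrow> real ^ 'n \<Rightarrow> (real \<Rightarrow> real ^ 'n) \<Rightarrow> bool" where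
  "solution_from t0 g x0 x \<longleftrightarrow> x t0 = x0 \<and>
     (\<forall>t\<ge>t0. (x has_vector_derivative g (x t) t) (at t within {t0..}))"

text \<open>The rate is Lebesgue integrable on bounded intervals only: requiring integrability on the
  whole half-line would exclude constant rates.\<close>

definition contraction_rate :: "real \<Rightarrow> (real \<Rightarrow> real) \<Rightarrow> bool" where
  "contraction_rate t0 \<gamma> \<longleftrightarrow>
     (\<forall>t>t0. \<gamma> absolutely_integrable_on {t0..t} \<and> integral {t0..t} \<gamma> > 0)"

definition contracting ::
  "real \<Rightarrow> real ^ 'n ^ 'n \<Rightarrow> (real ^ 'n \<Rightarrow> real \<Rightarrow> real ^ 'n) \<Rightarrow> (real \<Rightarrow> real) \<Rightarrow> bool" where
  "contracting t0 P g \<gamma> \<longleftrightarrow> contraction_rate t0 \<gamma> \<and>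
     (\<forall>x y. \<forall>t\<ge>t0. (x - y) \<bullet> (P *v (g x t - g y t)) \<le> - \<gamma> t * (weighted_norm P (x - y))\<^sup>2)"

definition implicit_euler ::
  "real \<Rightarrow> (real ^ 'n \<Rightarrow> real \<Rightarrow> real ^ 'n) \<Rightarrow> (nat \<Rightarrow> real ^ 'n) \<Rightarrow> bool" where
  "implicit_euler h g y \<longleftrightarrow>
     (\<forall>k. y (Suc k) = y k + h *\<^sub>R g (y (Suc k)) (real (Suc k) * h))"


subsection \<open>Well-definedness of the square root\<close>

lemma symmetric_inner:
  fixes A :: "real ^ 'n ^ 'n"
  assumes "transpose A = A"
  shows "x \<bullet> (A *v y) = (A *v x) \<bullet> y"
  by (metis assms dot_lmul_matrix transpose_matrix_vector)

lemma symmetric_eigenvector_in_subspace: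
  fixes A :: "real ^ 'n ^ 'n"
  assumes A: "transpose A = A" and V: "subspace V" and inv: "\<And>x. x \<in> V \<Longrightarrow> A *v x \<in> V"
    and ne: "V \<noteq> {0}"
  obtains v where "v \<in> V" "norm v = 1" "A *v v = (v \<bullet> (A *v v)) *\<^sub>R v"
proof -
  let ?K = "sphere 0 1 \<inter> V"
  have K: "compact ?K"
    using closed_subspace[OF V] by (intro compact_Int_closed compact_sphere)
  obtain w where w: "w \<in> V" "w \<noteq> 0"
    using ne V subspace_0 by blast
  have "(1 / norm w) *\<^sub>R w \<in> ?K"
    using w V by (simp add: subspace_scale)
  then have Kne: "?K \<noteq> {}" by blast
  have cont: "continuous_on ?K (\<lambda>x. x \<bullet> (A *v x))"
    by (intro continuous_intros linear_continuous_on matrix_vector_mul_bounded_linear)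
  obtain v where v: "v \<in> ?K" and max: "\<And>x. x \<in> ?K \<Longrightarrow> x \<bullet> (A *v x) \<le> v \<bullet> (A *v v)"
    using continuous_attains_sup[OF K Kne cont] by blast
  define l where "l = v \<bullet> (A *v v)"
  define q where "q = (\<lambda>x. l * (x \<bullet> x) - x \<bullet> (A *v x))"
  have vV: "v \<in> V" and nv: "norm v = 1" using v by auto
  have vv: "v \<bullet> v = 1" using nv by (simp add: dot_square_norm)
  have q0: "0 \<le> q x" if x: "x \<in> V" for x
  proof (cases "x = 0")
    case False
    let ?u = "(1 / norm x) *\<^sub>R x"
    have "?u \<in> ?K" using False x V by (simp add: subspace_scale)
    from max[OF this] have "(x \<bullet> (A *v x)) / (norm x * norm x) \<le> l"
      by (simp add: l_def matrix_vector_mult_scaleR)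
    then show ?thesis using False
      by (simp add: q_def divide_le_eq dot_square_norm power2_eq_square)
  qed (simp add: q_def)
  define w where "w = l *\<^sub>R v - A *v v"
  have wV: "w \<in> V" unfolding w_def by (intro subspace_diff[OF V] subspace_scale[OF V] vV inv)
  have exp: "q (v + t *\<^sub>R w) = 2 * t * (w \<bullet> w) + t\<^sup>2 * q w" for t
  proof -
    have 1: "w \<bullet> (A *v v) = v \<bullet> (A *v w)"
      by (metis A symmetric_inner inner_commute)
    have 2: "v \<bullet> (A *v w) = l * (v \<bullet> w) - w \<bullet> w"
      unfolding 1[symmetric] by (subst (3) w_def) (simp add: inner_diff_right inner_commute)
    show ?thesis
      unfolding q_def
      by (simp add: matrix_vector_right_distrib matrix_vector_mult_scaleR inner_add_left
          inner_add_right 1 2 inner_commute[of w v] vv l_def[symmetric] algebra_simps power2_eq_square)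
  qed
  have "w \<bullet> w = 0"
  proof (rule ccontr)
    assume "w \<bullet> w \<noteq> 0"
    then have pos: "w \<bullet> w > 0" by simp
    define t where "t = - (w \<bullet> w) / (q w + 1)"
    have qw: "q w \<ge> 0" using q0 wV by simp
    have "v + t *\<^sub>R w \<in> V" by (intro subspace_add[OF V] subspace_scale[OF V] vV wV)
    then have "0 \<le> 2 * t * (w \<bullet> w) + t\<^sup>2 * q w" using exp q0 by metis
    also have "\<dots> \<le> 2 * t * (w \<bullet> w) + t\<^sup>2 * (q w + 1)" by (simp add: algebra_simps)
    also have "t\<^sup>2 * (q w + 1) = - t * (w \<bullet> w)"
    proof -
      have "t * (q w + 1) = - (w \<bullet> w)" using qw by (simp add: t_def)
      then show ?thesis by (simp add: power2_eq_square mult.assoc)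
    qed
    also have "2 * t * (w \<bullet> w) + - t * (w \<bullet> w) = - ((w \<bullet> w)\<^sup>2 / (q w + 1))"
      by (simp add: t_def power2_eq_square algebra_simps)
    also have "\<dots> < 0" using pos qw by simp
    finally show False by simp
  qed
  then have "A *v v = l *\<^sub>R v" by (simp add: w_def)
  then show ?thesis using that vV nv l_def by blast
qed

lemma symmetric_eigenbasis_subspace:
  fixes A :: "real ^ 'n ^ 'n"
  assumes A: "transpose A = A" and "subspace V" and "\<And>x. x \<in> V \<Longrightarrow> A *v x \<in> V"
  shows "\<exists>B. finite B \<and> span B = V \<and> pairwise orthogonal B \<and>
     (\<forall>b\<in>B. norm b = 1 \<and> A *v b = (b \<bullet> (A *v b)) *\<^sub>R b)"
  using assms(2,3)
proof (induction "dim V" arbitrary: V rule: less_induct)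
  case less
  note V = less.prems(1) and inv = less.prems(2)
  show ?case
  proof (cases "V = {0}")
    case True
    then show ?thesis by (intro exI[of _ "{}"]) auto
  next
    case False
    obtain v where v: "v \<in> V" "norm v = 1" "A *v v = (v \<bullet> (A *v v)) *\<^sub>R v"
      using symmetric_eigenvector_in_subspace[OF A V inv False] by blast
    have vv: "v \<bullet> v = 1" using v(2) by (simp add: dot_square_norm)
    define W where "W = {x \<in> V. v \<bullet> x = 0}"
    have W: "subspace W"
      using V unfolding W_def subspace_def by (auto simp: inner_add_right)
    have "v \<notin> W" using vv by (simp add: W_def)
    then have "W \<subset> V" using v(1) unfolding W_def by blast
    then have dim: "dim W < dim V"
      by (metis V W dim_psubset span_eq_iff)
    have invW: "A *v x \<in> W" if "x \<in> W" for x
    proof -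
      have "v \<bullet> (A *v x) = (A *v v) \<bullet> x" by (rule symmetric_inner[OF A])
      also have "\<dots> = (v \<bullet> (A *v v)) * (v \<bullet> x)" by (subst v(3)) simp
      finally show ?thesis using that inv by (simp add: W_def)
    qed
    obtain B where B: "finite B" "span B = W" "pairwise orthogonal B"
      "\<forall>b\<in>B. norm b = 1 \<and> A *v b = (b \<bullet> (A *v b)) *\<^sub>R b"
      using less.hyps[OF dim W invW] by blast
    have BW: "B \<subseteq> W" using B(2) span_superset by blast
    have "span (insert v B) = V"
    proof
      show "span (insert v B) \<subseteq> V"
        using BW v(1) by (intro span_minimal[OF _ V]) (auto simp: W_def)
      show "V \<subseteq> span (insert v B)"
      proof
        fix x assume x: "x \<in> V"
        have "x - (v \<bullet> x) *\<^sub>R v \<in> span B"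
          unfolding B(2) W_def using x v(1) V vv
          by (auto simp: inner_diff_right intro!: subspace_diff subspace_scale)
        then show "x \<in> span (insert v B)" by (auto simp: span_insert)
      qed
    qed
    moreover have "pairwise orthogonal (insert v B)"
      using B(3) BW by (auto simp: pairwise_insert orthogonal_def W_def inner_commute)
    ultimately show ?thesis
      using B(1,4) v by (intro exI[of _ "insert v B"]) auto
  qed
qed

lemma symmetric_eigenbasis:
  fixes A :: "real ^ 'n ^ 'n"
  assumes "transpose A = A"
  obtains B where "finite B" "span B = UNIV" "pairwise orthogonal B" "\<And>b. b \<in> B \<Longrightarrow> norm b = 1"
    "\<And>b. b \<in> B \<Longrightarrow> A *v b = (b \<bullet> (A *v b)) *\<^sub>R b"
  using symmetric_eigenbasis_subspace[OF assms, of UNIV] by auto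

lemma matrix_eq_on_span:
  fixes A C :: "real ^ 'n ^ 'n"
  assumes "span B = UNIV" "\<And>b. b \<in> B \<Longrightarrow> A *v b = C *v b"
  shows "A = C"
proof -
  have "A *v x = C *v x" for x
    using linear_eq_on_span[OF matrix_vector_mul_linear[of A] matrix_vector_mul_linear[of C],
        of B x] assms by auto
  then show ?thesis by (simp add: matrix_eq)
qed

lemma exists_matrix_sqrt:
  fixes P :: "real ^ 'n ^ 'n"
  assumes P: "sym_posdef P"
  shows "\<exists>S. sym_posdef S \<and> S ** S = P"
proof -
  obtain B where B: "finite B" "span B = UNIV" "pairwise orthogonal B"
    and n1: "\<And>b. b \<in> B \<Longrightarrow> norm b = 1" and ev: "\<And>b. b \<in> B \<Longrightarrow> P *v b = (b \<bullet> (P *v b)) *\<^sub>R b"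
    using symmetric_eigenbasis[of P] P unfolding sym_posdef_def by metis
  define l where "l = (\<lambda>b. b \<bullet> (P *v b))"
  define f where "f = (\<lambda>x. \<Sum>b\<in>B. (sqrt (l b) * (b \<bullet> x)) *\<^sub>R b)"
  have l: "l b > 0" if "b \<in> B" for b
    using P n1[OF that] unfolding sym_posdef_def l_def by (metis norm_zero zero_neq_one)
  have "linear f"
    by (rule linearI)
      (simp_all add: f_def inner_add_right algebra_simps sum.distrib scaleR_right.sum)
  then have S: "matrix f *v x = f x" for x
    by (simp add: matrix_works linear_matrix_vector_mul_eq)
  have inner_f: "x \<bullet> f y = (\<Sum>b\<in>B. sqrt (l b) * (b \<bullet> x) * (b \<bullet> y))" for x y
    by (simp add: f_def inner_sum_right inner_commute[of x] mult_ac)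
  have "transpose (matrix f) *v x = matrix f *v x" for x
  proof -
    have "(transpose (matrix f) *v x) \<bullet> y = (matrix f *v x) \<bullet> y" for y
      unfolding transpose_matrix_vector dot_lmul_matrix S inner_f
      by (subst inner_commute) (simp add: inner_f mult_ac)
    then show ?thesis by (metis vector_eq_rdot)
  qed
  then have sym: "transpose (matrix f) = matrix f" by (simp add: matrix_eq)
  have pos: "x \<bullet> (matrix f *v x) > 0" if "x \<noteq> 0" for x
  proof -
    have expand: "(\<Sum>b\<in>B. (x \<bullet> b) *\<^sub>R b) = x"
      by (rule orthonormal_basis_expand[OF B(3) n1 _ B(1)]) (simp_all add: B(2))
    have "\<exists>b\<in>B. b \<bullet> x \<noteq> 0"
    proof (rule ccontr)
      assume "\<not> (\<exists>b\<in>B. b \<bullet> x \<noteq> 0)"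
      then have "(\<Sum>b\<in>B. (x \<bullet> b) *\<^sub>R b) = 0"
        by (intro sum.neutral) (simp add: inner_commute)
      then show False using expand that by simp
    qed
    then obtain b where b: "b \<in> B" "b \<bullet> x \<noteq> 0" by blast
    have "0 < (\<Sum>b\<in>B. sqrt (l b) * (b \<bullet> x)\<^sup>2)"
      by (rule sum_pos2[OF B(1) b(1)]) (use b l in \<open>auto simp: less_imp_le\<close>)
    then show ?thesis by (simp add: S inner_f power2_eq_square mult_ac)
  qed
  have fb: "f b = sqrt (l b) *\<^sub>R b" if "b \<in> B" for b
  proof -
    have "f b = (\<Sum>c\<in>B. if c = b then sqrt (l b) *\<^sub>R b else 0)"
      unfolding f_def
    proof (rule sum.cong[OF refl])
      fix c assume "c \<in> B"
      then show "(sqrt (l c) * (c \<bullet> b)) *\<^sub>R c = (if c = b then sqrt (l b) *\<^sub>R b else 0)"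
        using B(3) that n1 by (auto simp: pairwise_def orthogonal_def dot_square_norm)
    qed
    then show ?thesis using B(1) that by simp
  qed
  have "matrix f ** matrix f = P"
  proof (rule matrix_eq_on_span[OF B(2)])
    fix b assume b: "b \<in> B"
    have "(matrix f ** matrix f) *v b = matrix f *v (matrix f *v b)"
      by (simp add: matrix_vector_mul_assoc)
    also have "\<dots> = (sqrt (l b) * sqrt (l b)) *\<^sub>R b"
      by (simp add: S[of b] fb[OF b] matrix_vector_mult_scaleR)
    also have "\<dots> = l b *\<^sub>R b" using l[OF b] by simp
    finally show "(matrix f ** matrix f) *v b = P *v b" using ev[OF b] by (simp add: l_def)
  qed
  then show ?thesis using sym pos unfolding sym_posdef_def by blast
qed

lemma matrix_sqrt_unique:
  fixes S T :: "real ^ 'n ^ 'n"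
  assumes S: "sym_posdef S" and T: "sym_posdef T" and eq: "S ** S = T ** T"
  shows "S = T"
proof -
  define D where "D = S - T"
  have tS: "transpose S = S" and tT: "transpose T = T" using S T by (auto simp: sym_posdef_def)
  have D: "D *v x = S *v x - T *v x" for x
    by (simp add: D_def matrix_vector_mult_diff_rdistrib)
  have tD: "transpose D = D"
    using tS tT by (simp add: D_def transpose_def vec_eq_iff)
  obtain B where B: "span B = UNIV" and n1: "\<And>b. b \<in> B \<Longrightarrow> norm b = 1"
    and ev: "\<And>b. b \<in> B \<Longrightarrow> D *v b = (b \<bullet> (D *v b)) *\<^sub>R b"
    using symmetric_eigenbasis[OF tD] by metis
  show ?thesis
  proof (rule matrix_eq_on_span[OF B])
    fix b assume b: "b \<in> B"
    define m where "m = b \<bullet> (D *v b)"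
    have Db: "D *v b = m *\<^sub>R b" using ev[OF b] m_def by simp
    have "b \<noteq> 0" using n1[OF b] by auto
    then have pos: "b \<bullet> (S *v b) > 0" "b \<bullet> (T *v b) > 0" using S T by (auto simp: sym_posdef_def)
    have "S *v (S *v b) = T *v (T *v b)" using eq by (simp add: matrix_vector_mul_assoc)
    then have "b \<bullet> (S *v (D *v b)) + b \<bullet> (D *v (T *v b)) = 0"
      by (simp add: D matrix_vector_mult_diff_distrib inner_diff_right)
    then have "m * (b \<bullet> (S *v b) + b \<bullet> (T *v b)) = 0"
      unfolding symmetric_inner[OF tD] Db by (simp add: matrix_vector_mult_scaleR algebra_simps)
    then have "m = 0" using pos by simp
    then show "S *v b = T *v b" using Db D by simp
  qed
qed

lemma ex1_matrix_sqrt: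
  fixes P :: "real ^ 'n ^ 'n"
  assumes "sym_posdef P"
  shows "\<exists>!S. sym_posdef S \<and> S ** S = P"
  using exists_matrix_sqrt[OF assms] matrix_sqrt_unique by blast

lemma weighted_norm_eq:
  fixes P :: "real ^ 'n ^ 'n"
  assumes "sym_posdef P"
  shows "weighted_norm P x = sqrt (x \<bullet> (P *v x))"
proof -
  let ?S = "matrix_sqrt P"
  have S: "sym_posdef ?S" "?S ** ?S = P"
    using theI'[OF ex1_matrix_sqrt[OF assms]] unfolding matrix_sqrt_def by auto
  have "x \<bullet> (P *v x) = x \<bullet> (?S *v (?S *v x))"
    by (simp add: S(2) matrix_vector_mul_assoc)
  also have "\<dots> = (?S *v x) \<bullet> (?S *v x)"
    using S(1) by (intro symmetric_inner) (simp add: sym_posdef_def)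
  finally show ?thesis by (simp add: weighted_norm_def norm_eq_sqrt_inner)
qed

end

theory Submission
  imports Defs
begin

text \<open>One implicit Euler step towards an equilibrium \<open>x\<close> of the vector field at the new time
  satisfies \<open>(1 + h \<gamma>) \<parallel>y' - x\<parallel> \<le> \<parallel>y - x\<parallel>\<close>: pair \<open>y' - x = (y - x) + h (g y' - g x)\<close> with \<open>y' - x\<close>
  in the inner product of \<open>P\<close>, and apply the Cauchy-Schwarz inequality and the one-sided Lipschitz
  condition. The displacement of the equilibrium between two grid points enters by the triangle
  inequality, and the resulting linear recursion is solved explicitly.\<close>

text \<open>Writing \<open>P\<close> as \<open>S ** S\<close> with \<open>S\<close> symmetric turns
  its inner product into the Euclidean one of the images under \<open>S\<close>, where
  Cauchy-Schwarz is available.\<close>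

lemma
  fixes P :: "real ^ 'n ^ 'n"
  assumes "sym_posdef P"
  shows inner_le_weighted_norm: "x \<bullet> (P *v y) \<le> weighted_norm P x * weighted_norm P y"
    and weighted_norm_power2: "(weighted_norm P x)\<^sup>2 = x \<bullet> (P *v x)"
proof -
  let ?S = "matrix_sqrt P"
  have S: "sym_posdef ?S" "?S ** ?S = P"
    using theI'[OF ex1_matrix_sqrt[OF assms]] unfolding matrix_sqrt_def by auto
  have eq: "x \<bullet> (P *v y) = (?S *v x) \<bullet> (?S *v y)" for x y
  proof -
    have "x \<bullet> (P *v y) = x \<bullet> (?S *v (?S *v y))"
      by (simp add: S(2) matrix_vector_mul_assoc)
    also have "\<dots> = (?S *v x) \<bullet> (?S *v y)"
      using S(1) by (intro symmetric_inner) (simp add: sym_posdef_def)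
    finally show ?thesis .
  qed
  show "x \<bullet> (P *v y) \<le> weighted_norm P x * weighted_norm P y"
    unfolding eq weighted_norm_def by (rule norm_cauchy_schwarz)
  show "(weighted_norm P x)\<^sup>2 = x \<bullet> (P *v x)"
    unfolding eq weighted_norm_def by (simp add: dot_square_norm)
qed

lemma weighted_norm_nonneg [simp]: "0 \<le> weighted_norm P x"
  by (simp add: weighted_norm_def)

lemma weighted_norm_zero [simp]: "weighted_norm P 0 = 0"
  by (simp add: weighted_norm_def)

lemma weighted_norm_triangle: "weighted_norm P (x + y) \<le> weighted_norm P x + weighted_norm P y"
  by (simp add: weighted_norm_def matrix_vector_right_distrib norm_triangle_ineq)

lemma weighted_norm_minus_commute: "weighted_norm P (x - y) = weighted_norm P (y - x)"
  by (simp add: weighted_norm_def matrix_vector_mult_diff_distrib norm_minus_commute)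

lemma implicit_euler_step_contraction:
  fixes P :: "real ^ 'n ^ 'n"
  assumes P: "sym_posdef P" and "contracting 0 P g \<gamma>" and h: "h > 0"
    and euler: "implicit_euler h g y" and eq: "g x (real (Suc k) * h) = 0"
  shows "(1 + h * \<gamma> (real (Suc k) * h)) * weighted_norm P (y (Suc k) - x)
    \<le> weighted_norm P (y k - x)"
proof -
  let ?t = "real (Suc k) * h"
  let ?z = "y (Suc k) - x" and ?w = "y k - x"
  have "y (Suc k) = y k + h *\<^sub>R g (y (Suc k)) ?t"
    using euler unfolding implicit_euler_def by blast
  then have z: "?z = ?w + h *\<^sub>R (g (y (Suc k)) ?t - g x ?t)"
    using eq by (simp add: algebra_simps)
  have lip: "?z \<bullet> (P *v (g (y (Suc k)) ?t - g x ?t)) \<le> - \<gamma> ?t * (weighted_norm P ?z)\<^sup>2"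
    using assms(2) h unfolding contracting_def by simp
  \<comment> \<open>The Euler identity is substituted in the second argument only. Keeping
    \<open>?z\<close> in the first gives exactly the pairing that the one-sided Lipschitz condition
    controls.\<close>
  have "(weighted_norm P ?z)\<^sup>2 = ?z \<bullet> (P *v (?w + h *\<^sub>R (g (y (Suc k)) ?t - g x ?t)))"
    unfolding weighted_norm_power2[OF P] z[symmetric] ..
  also have "\<dots> = ?z \<bullet> (P *v ?w) + h * (?z \<bullet> (P *v (g (y (Suc k)) ?t - g x ?t)))"
    by (simp only: matrix_vector_right_distrib matrix_vector_mult_scaleR inner_add_right
        inner_scaleR_right)
  also have "\<dots> \<le> weighted_norm P ?z * weighted_norm P ?w
      + h * (- \<gamma> ?t * (weighted_norm P ?z)\<^sup>2)"
    using h by (intro add_mono inner_le_weighted_norm[OF P] mult_left_mono lip) auto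
  finally have "weighted_norm P ?z * ((1 + h * \<gamma> ?t) * weighted_norm P ?z)
      \<le> weighted_norm P ?z * weighted_norm P ?w"
    by (simp add: algebra_simps power2_eq_square)
  \<comment> \<open>The common factor \<open>weighted_norm P ?z\<close> cancels when it is positive.
    When it is zero, the left side of the claim vanishes and the right side is a norm.\<close>
  then show ?thesis
    using weighted_norm_nonneg[of P ?z]
    by (cases "weighted_norm P ?z = 0") (simp_all add: mult_le_cancel_left)
qed

text \<open>Induction on \<open>k\<close>, unrolling the recursion. The perturbation
  \<open>d m\<close> enters inside the bracket of step \<open>m\<close>, so it is damped by
  \<open>q m\<close> as well: its product starts at \<open>m\<close>, not at
  \<open>m + 1\<close>.\<close>

lemma linear_recursion_bound:
  fixes a d q :: "nat \<Rightarrow> real"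
  assumes q: "\<And>k. 0 \<le> q k" and step: "\<And>k. a (Suc k) \<le> q (Suc k) * (a k + d (Suc k))"
  shows "a k \<le> (\<Prod>m=1..k. q m) * a 0 + (\<Sum>m=1..k. (\<Prod>r=m..k. q r) * d m)"
proof (induction k)
  case (Suc k)
  \<comment> \<open>The case \<open>m = Suc k\<close>, with an empty product on the right, is
    included; it covers the newly added summand.\<close>
  have prod: "(\<Prod>r=m..Suc k. q r) = q (Suc k) * (\<Prod>r=m..k. q r)" if "m \<le> Suc k" for m
    using that by (simp add: prod.nat_ivl_Suc')
  have sum: "(\<Sum>m=1..k. (\<Prod>r=m..Suc k. q r) * d m)
      = q (Suc k) * (\<Sum>m=1..k. (\<Prod>r=m..k. q r) * d m)"
    unfolding sum_distrib_left by (intro sum.cong refl) (simp add: prod mult.assoc)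
  have "a (Suc k) \<le> q (Suc k) * (a k + d (Suc k))"
    by (rule step)
  also have "\<dots> \<le> q (Suc k) * ((\<Prod>m=1..k. q m) * a 0
      + (\<Sum>m=1..k. (\<Prod>r=m..k. q r) * d m) + d (Suc k))"
    using Suc.IH q by (intro mult_left_mono add_mono) auto
  also have "\<dots> = (\<Prod>m=1..Suc k. q m) * a 0
      + ((\<Sum>m=1..k. (\<Prod>r=m..Suc k. q r) * d m) + (\<Prod>r=Suc k..Suc k. q r) * d (Suc k))"
    unfolding sum by (subst prod) (simp_all add: algebra_simps)
  also have "\<dots> = (\<Prod>m=1..Suc k. q m) * a 0 + (\<Sum>m=1..Suc k. (\<Prod>r=m..Suc k. q r) * d m)"
    by simp
  finally show ?case .
qed simp

text \<open>Both parts of the theorem are read off from this bound: a constant curve has no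
  displacements, and a constant rate turns the products into powers.\<close>

lemma implicit_euler_tracking_bound:
  fixes P :: "real ^ 'n ^ 'n"
  assumes P: "sym_posdef P" and contr: "contracting 0 P g \<gamma>" and pos: "\<forall>t\<ge>0. \<gamma> t > 0"
    and h: "h > 0" and euler: "implicit_euler h g y" and eq: "\<forall>t\<ge>0. g (xs t) t = 0"
  shows "weighted_norm P (y k - xs (real k * h))
    \<le> (\<Prod>m=1..k. inverse (1 + h * \<gamma> (real m * h))) * weighted_norm P (y 0 - xs 0)
      + (\<Sum>m=1..k. (\<Prod>r=m..k. inverse (1 + h * \<gamma> (real r * h)))
          * weighted_norm P (xs (real m * h) - xs ((real m - 1) * h)))"
proof -
  define q where "q = (\<lambda>m. inverse (1 + h * \<gamma> (real m * h)))"
  define a where "a = (\<lambda>k. weighted_norm P (y k - xs (real k * h)))"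
  define d where "d = (\<lambda>m. weighted_norm P (xs (real m * h) - xs ((real m - 1) * h)))"
  have pos': "0 < 1 + h * \<gamma> (real k * h)" for k
    using h pos by (simp add: add_pos_pos)
  have "a (Suc k) \<le> q (Suc k) * (a k + d (Suc k))" for k
  proof -
    let ?x = "xs (real (Suc k) * h)"
    \<comment> \<open>The scheme evaluates \<open>g\<close> at the new time, so the old iterate is
      first compared with the new equilibrium \<open>?x\<close>.\<close>
    have "(1 + h * \<gamma> (real (Suc k) * h)) * a (Suc k) \<le> weighted_norm P (y k - ?x)"
      unfolding a_def using eq h
      by (intro implicit_euler_step_contraction[OF P contr h euler]) simp
    also have "\<dots> = weighted_norm P ((y k - xs (real k * h)) + (xs (real k * h) - ?x))"
      by simp
    also have "\<dots> \<le> a k + weighted_norm P (xs (real k * h) - ?x)"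
      unfolding a_def by (rule weighted_norm_triangle)
    also have "weighted_norm P (xs (real k * h) - ?x) = d (Suc k)"
      unfolding d_def by (subst weighted_norm_minus_commute) simp
    finally show ?thesis
      using pos'[of "Suc k"] by (simp add: q_def field_simps)
  qed
  moreover have "0 \<le> q k" for k
    using pos'[of k] by (simp add: q_def)
  ultimately have "a k \<le> (\<Prod>m=1..k. q m) * a 0 + (\<Sum>m=1..k. (\<Prod>r=m..k. q r) * d m)"
    by (intro linear_recursion_bound)
  then show ?thesis by (simp add: a_def q_def d_def)
qed

text \<open>For \<open>q = inverse (1 + b)\<close> one has \<open>b * q = 1 - q\<close>, so
  multiplying the geometric sum by \<open>b\<close> makes it telescope. With
  \<open>b = h * c\<close> the closed form exhibits the limit \<open>1 / (h * c)\<close>.\<close>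

lemma sum_power_inverse_one_plus:
  fixes b :: real
  assumes "b > 0"
  shows "(\<Sum>m=1..k. inverse (1 + b) ^ m) = (1 - inverse (1 + b) ^ k) / b"
proof -
  let ?q = "inverse (1 + b)"
  have q: "b * ?q = 1 - ?q"
    using assms by (simp add: field_simps)
  have "b * (\<Sum>m=1..k. ?q ^ m) = 1 - ?q ^ k"
  proof (induction k)
    case (Suc k)
    have "b * (\<Sum>m=1..Suc k. ?q ^ m) = 1 - ?q ^ k + (b * ?q) * ?q ^ k"
      using Suc.IH by (simp add: distrib_left mult.assoc)
    then show ?case
      by (simp add: q algebra_simps)
  qed simp
  then show ?thesis
    using assms by (simp add: eq_divide_eq mult.commute)
qed

theorem theorem3p1:
  fixes g :: "real ^ 'n \<Rightarrow> real \<Rightarrow> real ^ 'n"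
    and P :: "real ^ 'n ^ 'n"
    and \<gamma> :: "real \<Rightarrow> real"
    and h :: real
    and y :: "nat \<Rightarrow> real ^ 'n"
  assumes "\<forall>x0. \<exists>x. solution_from 0 g x0 x"
    and "sym_posdef P"
    and "contracting 0 P g \<gamma>"
    and "\<forall>t\<ge>0. \<gamma> t > 0"
    and "h > 0"
    and "implicit_euler h g y"
  shows
    "(\<forall>xs :: real ^ 'n. (\<forall>t\<ge>0. g xs t = 0) \<longrightarrow>
        (\<forall>k\<ge>1. weighted_norm P (y k - xs)
           \<le> (\<Prod>m=1..k. inverse (1 + h * \<gamma> (real m * h))) * weighted_norm P (y 0 - xs)) \<and>
        (\<forall>c>0. (\<forall>t\<ge>0. \<gamma> t = c) \<longrightarrow>
           (\<forall>k\<ge>1. weighted_norm P (y k - xs)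
              \<le> (1 + h * c) powi (- int k) * weighted_norm P (y 0 - xs)))) \<and>
     (\<forall>xs :: real \<Rightarrow> real ^ 'n. (\<forall>t\<ge>0. g (xs t) t = 0) \<longrightarrow>
        (\<forall>k\<ge>1. weighted_norm P (y k - xs (real k * h))
           \<le> (\<Prod>m=1..k. inverse (1 + h * \<gamma> (real m * h))) * weighted_norm P (y 0 - xs 0)
             + (\<Sum>m=1..k. (\<Prod>r=m..k. inverse (1 + h * \<gamma> (real r * h)))
                 * weighted_norm P (xs (real m * h) - xs ((real m - 1) * h)))) \<and>
        (\<forall>c>0. \<forall>\<rho>\<ge>0. (\<forall>t\<ge>0. \<gamma> t = c) \<longrightarrow>
           (SUP k\<in>{1::nat..}. ereal (weighted_norm P (xs (real k * h) - xs ((real k - 1) * h))))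
             \<le> ereal \<rho> \<longrightarrow>
           (\<forall>k\<ge>1. weighted_norm P (y k - xs (real k * h))
              \<le> (1 + h * c) powi (- int k) * weighted_norm P (y 0 - xs 0)
                + \<rho> * (\<Sum>m=1..k. (1 + h * c) powi (- int m))) \<and>
           limsup (\<lambda>k. ereal (weighted_norm P (y k - xs (real k * h)))) \<le> ereal (\<rho> / (h * c))))"
proof -
  have powi: "(1 + h * c) powi (- int k) = inverse (1 + h * c) ^ k" for c k
    by (simp add: power_int_minus power_inverse)
  note bound = implicit_euler_tracking_bound[OF assms(2-6)]
  \<comment> \<open>The exponent is the number of factors: \<open>k\<close> for
    \<open>i = 1\<close>, and \<open>Suc k - m\<close> for the product damping displacement
    \<open>m\<close>.\<close>
  have prod: "(\<Prod>m=i..k. inverse (1 + h * \<gamma> (real m * h))) = inverse (1 + h * c) ^ (Suc k - i)"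
    if "\<forall>t\<ge>0. \<gamma> t = c" for c i k
    using that \<open>h > 0\<close> by simp
  have fixed: "weighted_norm P (y k - xs)
      \<le> (\<Prod>m=1..k. inverse (1 + h * \<gamma> (real m * h))) * weighted_norm P (y 0 - xs)"
    if "\<forall>t\<ge>0. g xs t = 0" for xs k
    using bound[of "\<lambda>_. xs" k] that by simp
  have const: "weighted_norm P (y k - xs (real k * h))
      \<le> inverse (1 + h * c) ^ k * weighted_norm P (y 0 - xs 0)
        + \<rho> * (\<Sum>m=1..k. inverse (1 + h * c) ^ m)"
    if eq: "\<forall>t\<ge>0. g (xs t) t = 0" and c: "c > 0" "\<forall>t\<ge>0. \<gamma> t = c"
      and d: "\<And>m. m \<ge> 1 \<Longrightarrow> weighted_norm P (xs (real m * h) - xs ((real m - 1) * h)) \<le> \<rho>"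
    for xs c \<rho> k
  proof -
    let ?q = "inverse (1 + h * c)"
    have "?q \<ge> 0" using c \<open>h > 0\<close> by simp
    have "weighted_norm P (y k - xs (real k * h)) \<le> ?q ^ k * weighted_norm P (y 0 - xs 0)
        + (\<Sum>m=1..k. ?q ^ (Suc k - m) * weighted_norm P (xs (real m * h) - xs ((real m - 1) * h)))"
      using bound[OF eq, of k] by (simp add: prod[OF c(2)])
    also have "\<dots> \<le> ?q ^ k * weighted_norm P (y 0 - xs 0) + (\<Sum>m=1..k. ?q ^ (Suc k - m) * \<rho>)"
      using \<open>?q \<ge> 0\<close> by (intro add_left_mono sum_mono mult_left_mono d) auto
    \<comment> \<open>Reversing the summation order exchanges \<open>m\<close> and
      \<open>Suc k - m\<close>, which both range over \<open>1..k\<close>.\<close>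
    also have "(\<Sum>m=1..k. ?q ^ (Suc k - m) * \<rho>) = \<rho> * (\<Sum>m=1..k. ?q ^ m)"
      unfolding sum_distrib_left
      by (subst sum.atLeastAtMost_rev) (intro sum.cong, auto simp: mult.commute)
    finally show ?thesis .
  qed
  have lim: "limsup (\<lambda>k. ereal (weighted_norm P (y k - xs (real k * h)))) \<le> ereal (\<rho> / (h * c))"
    if eq: "\<forall>t\<ge>0. g (xs t) t = 0" and c: "c > 0" "\<forall>t\<ge>0. \<gamma> t = c"
      and d: "\<And>m. m \<ge> 1 \<Longrightarrow> weighted_norm P (xs (real m * h) - xs ((real m - 1) * h)) \<le> \<rho>"
    for xs c \<rho>
  proof -
    let ?q = "inverse (1 + h * c)"
    \<comment> \<open>The right side of \<open>const\<close> with its geometric sum in closed form.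
      Since \<open>?q ^ k\<close> tends to 0, only \<open>\<rho> / (h * c)\<close> survives in the
      limit.\<close>
    define b where "b = (\<lambda>k. ?q ^ k * weighted_norm P (y 0 - xs 0) + \<rho> * ((1 - ?q ^ k) / (h * c)))"
    have hc: "h * c > 0" using c \<open>h > 0\<close> by simp
    have "norm ?q < 1"
      using hc by (simp add: field_simps)
    then have "b \<longlonglongrightarrow> 0 * weighted_norm P (y 0 - xs 0) + \<rho> * ((1 - 0) / (h * c))"
      unfolding b_def using hc by (intro tendsto_intros LIMSEQ_power_zero) auto
    then have "(\<lambda>k. ereal (b k)) \<longlonglongrightarrow> ereal (\<rho> / (h * c))"
      by simp
    then have "limsup (\<lambda>k. ereal (b k)) = ereal (\<rho> / (h * c))"
      by (intro lim_imp_Limsup) simp_all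
    moreover have "weighted_norm P (y k - xs (real k * h)) \<le> b k" for k
      using const[OF eq c d, of k] unfolding b_def sum_power_inverse_one_plus[OF hc] by simp
    ultimately show ?thesis
      by (metis (no_types, lifting) Limsup_mono always_eventually ereal_less_eq(3))
  qed
  \<comment> \<open>The supremum is taken in \<open>ereal\<close>, where it is infinite for
    unbounded displacements; a finite bound on it therefore bounds every single
    displacement.\<close>
  have sup: "weighted_norm P (xs (real m * h) - xs ((real m - 1) * h)) \<le> \<rho>"
    if "(SUP k\<in>{1::nat..}. ereal (weighted_norm P (xs (real k * h) - xs ((real k - 1) * h))))
      \<le> ereal \<rho>" "m \<ge> 1" for xs \<rho> m
    using that by (auto simp: SUP_le_iff)
  show ?thesis
    unfolding powi
  proof (intro conjI allI impI)
    fix xs k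
    assume xs: "\<forall>t\<ge>0. g xs t = 0"
    show "weighted_norm P (y k - xs)
        \<le> (\<Prod>m=1..k. inverse (1 + h * \<gamma> (real m * h))) * weighted_norm P (y 0 - xs)"
      by (rule fixed[OF xs])
    fix c
    assume c: "\<forall>t\<ge>0. \<gamma> t = c"
    show "weighted_norm P (y k - xs) \<le> inverse (1 + h * c) ^ k * weighted_norm P (y 0 - xs)"
      using fixed[OF xs, of k] by (simp add: prod[OF c])
  next
    fix xs c \<rho>
    assume *: "\<forall>t\<ge>0. g (xs t) t = 0" "c > 0" "\<forall>t\<ge>0. \<gamma> t = c"
      and "(SUP k\<in>{1::nat..}. ereal (weighted_norm P (xs (real k * h) - xs ((real k - 1) * h))))
        \<le> ereal \<rho>"
    note d = sup[OF this(4)]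
    show "limsup (\<lambda>k. ereal (weighted_norm P (y k - xs (real k * h)))) \<le> ereal (\<rho> / (h * c))"
      by (rule lim[OF * d])
    fix k
    show "weighted_norm P (y k - xs (real k * h))
        \<le> inverse (1 + h * c) ^ k * weighted_norm P (y 0 - xs 0)
          + \<rho> * (\<Sum>m=1..k. inverse (1 + h * c) ^ m)"
      by (rule const[OF * d])
  qed (rule bound)
qed

end
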